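(* Let $G=\mathbb{Z}_{n_1}\times\cdots\times\mathbb{Z}_{n_d}$, where $n_1,\ldots,n_d\ge 2$, and let $S$ be an inverse-closed subset of $G\setminus\{(0,\ldots,0)\}$ with $\langle S\rangle=G$. Let $S_0=S\cup\{(0,\ldots,0)\}$. Suppose that $|S_0|=p$ is a prime and that exactly one of $n_1,\ldots,n_d$, say $n_t$, is divisible by $p$. Then $\mathrm{Cay}(G,S)$ admits a perfect code if and only if $s_t\not\equiv s'_t \pmod p$ for each pair of distinct elements $(s_1,\ldots,s_d),(s'_1,\ldots,s'_d)$ of $S_0$.
   Context: Inverse-closed means $-S=S$. The Cayley graph $\mathrm{Cay}(G,S)$ has vertex set $G$, with $x,y$ adjacent iff $y-x\in S$. A perfect code in a graph is a set $C$ of vertices such that no two vertices in $C$ are adjacent and every vertex outside $C$ is adjacent to exactly one vertex of $C$. Congruence of elements of $\mathbb{Z}_{n_t}$ modulo $p$ makes sense since $p\mid n_t$. *)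

theory Defs
  imports
    "HOL-Algebra.Product_Groups"
    "HOL-Number_Theory.Cong"
    "HOL-Computational_Algebra.Primes"
    "Graph_Theory.Pair_Digraph"
begin

text \<open>Elements of \<open>Z_prod d n\<close> are the functions \<open>x\<close> with \<open>x i \<in> {0..<n i}\<close> for
  \<open>1 \<le> i \<le> d\<close> (provided \<open>n i > 0\<close>) and \<open>x i = undefined\<close> for every other \<open>i\<close>.\<close>

definition Z_prod :: "nat \<Rightarrow> (nat \<Rightarrow> nat) \<Rightarrow> (nat \<Rightarrow> int) monoid" where
  "Z_prod d n = product_group {1..d} (\<lambda>i. integer_mod_group (n i))"

text \<open>The difference \<open>y - x\<close> is \<open>y \<otimes> inv x\<close> in the multiplicative notation of HOL-Algebra.
  An undirected edge is represented by its two arcs, as in the locale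
  \<^locale>\<open>pair_graph\<close>.\<close>

definition Cay :: "('a, 'b) monoid_scheme \<Rightarrow> 'a set \<Rightarrow> 'a pair_pre_digraph" where
  "Cay G S = \<lparr> pverts = carrier G,
     parcs = {(x, y). x \<in> carrier G \<and> y \<in> carrier G \<and> y \<otimes>\<^bsub>G\<^esub> inv\<^bsub>G\<^esub> x \<in> S} \<rparr>"

lemma pair_graph_Cay:
  assumes "group G" "finite (carrier G)" "\<one>\<^bsub>G\<^esub> \<notin> S" "m_inv G ` S = S"
  shows "pair_graph (Cay G S)"
proof -
  interpret group G by fact
  have inv_S: "x \<otimes>\<^bsub>G\<^esub> inv\<^bsub>G\<^esub> y \<in> S"
    if "x \<in> carrier G" "y \<in> carrier G" "y \<otimes>\<^bsub>G\<^esub> inv\<^bsub>G\<^esub> x \<in> S" for x y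
  proof -
    have "inv\<^bsub>G\<^esub> (y \<otimes>\<^bsub>G\<^esub> inv\<^bsub>G\<^esub> x) \<in> S"
      using that(3) assms(4) by blast
    then show ?thesis using that by (simp add: inv_mult_group)
  qed
  have "finite (parcs (Cay G S))"
    by (rule finite_subset[of _ "carrier G \<times> carrier G"]) (auto simp: Cay_def assms(2))
  moreover have "sym (parcs (Cay G S))"
    by (auto simp: Cay_def sym_def inv_S)
  ultimately show ?thesis
    using assms(2,3)
    by unfold_locales (auto simp: Cay_def symmetric_def arcs_ends_def arc_to_ends_def with_proj_def)
qed

definition perfect_code :: "'a pair_pre_digraph \<Rightarrow> 'a set \<Rightarrow> bool" where
  "perfect_code \<Gamma> C \<longleftrightarrow>
     C \<subseteq> pverts \<Gamma> \<and>
     (\<forall>x\<in>C. \<forall>y\<in>C. (x, y) \<notin> parcs \<Gamma>) \<and>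
     (\<forall>v\<in>pverts \<Gamma> - C. \<exists>!c. c \<in> C \<and> (v, c) \<in> parcs \<Gamma>)"

end

theory Submission
  imports Defs "HOL-Combinatorics.Orbits"
begin

text \<open>
  A perfect code in \<open>Cay(G, S)\<close> is the same as a set \<open>C\<close> such that every element of \<open>G\<close> is
  uniquely of the form \<open>c - s\<close> with \<open>c \<in> C\<close> and \<open>s \<in> S\<^sub>0\<close>, that is, a complement of a factor
  with \<open>p\<close> elements (\<open>perfect_code_Cay_iff\<close>). Write \<open>\<pi>(x)\<close> for \<open>x\<^sub>t\<close> modulo \<open>p\<close>, which is a
  homomorphism from \<open>G\<close> onto the integers modulo \<open>p\<close>.

  If \<open>\<pi>\<close> is injective on \<open>S\<^sub>0\<close>, then it maps the \<open>p\<close> elements of \<open>S\<^sub>0\<close> bijectively onto the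
  residues modulo \<open>p\<close>, so its kernel is a perfect code.

  The converse rests on the fact that a complement \<open>C\<close> is a union of cosets of \<open>p G\<close>. In the group
  ring, with a set standing for the sum of its elements, the factorisation reads \<open>A C = G\<close> with
  \<open>A = - S\<^sub>0\<close>, hence \<open>A\<^sup>p C = p\<^bsup>p-1\<^esup> G\<close>, which vanishes modulo \<open>p\<close>. Since \<open>A\<^sup>p\<close> is congruent
  modulo \<open>p\<close> to the sum of the \<open>p a\<close> with \<open>a \<in> A\<close>, the number of \<open>s \<in> S\<^sub>0\<close> with \<open>g + p s \<in> C\<close> is
  divisible by \<open>p\<close> for every \<open>g\<close>. This number lies between \<open>0\<close> and \<open>p\<close>, so it is \<open>0\<close> or \<open>p\<close>. For
  \<open>g \<in> C\<close> the element \<open>s = 0\<close> counts, so all \<open>s\<close> do: \<open>C\<close> is closed under adding \<open>p s\<close>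
  (\<open>tiling_absorbs_powers\<close>). As \<open>S\<close> generates \<open>G\<close>, \<open>C\<close> is closed under adding elements of \<open>p G\<close>.

  Because \<open>p\<close> divides \<open>n\<^sub>t\<close> only, \<open>p G\<close> is the whole kernel of \<open>\<pi>\<close> (\<open>Z_prod_prime_multiple\<close>). So
  if \<open>s \<noteq> s'\<close> in \<open>S\<^sub>0\<close> had \<open>\<pi>(s) = \<pi>(s')\<close>, then for \<open>c \<in> C\<close> both \<open>c\<close> and \<open>c + (s' - s)\<close> would lie
  in \<open>C\<close>, and \<open>c - s\<close> would have two representations.

  The congruence for \<open>A\<^sup>p\<close> is proved by counting: rotation acts on the \<open>p\<close>-tuples over \<open>A\<close> and
  preserves the sum of a tuple, its orbits have \<open>1\<close> or \<open>p\<close> elements, and the fixed tuples are the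
  constant ones (\<open>prime_dvd_card_power_translates\<close>).
\<close>

section \<open>Fixed points of a map whose \<open>p\<close>-th iterate is the identity\<close>

text \<open>The exponents of iterates fixing \<open>x\<close> are closed under multiples, and Bezout gives two such
  exponents that differ by \<open>1\<close>.\<close>

lemma funpow_coprime_fixed:
  fixes i p :: nat
  assumes "(f ^^ i) x = x" "(f ^^ p) x = x" "coprime i p"
  shows "f x = x"
proof (cases "i = 0")
  case True
  then show ?thesis using assms by simp
next
  case False
  then obtain a b where ab: "i * a = p * b + 1"
    using bezout_nat[of i p] assms(3) by auto
  have iterate: "(f ^^ (k * m)) x = x" if "(f ^^ k) x = x" for k m
    using that by (induction m) (auto simp: funpow_add)
  have "x = (f ^^ (p * b + 1)) x"
    using iterate[OF assms(1), of a] ab by simp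
  also have "\<dots> = f x"
    using iterate[OF assms(2), of b] by simp
  finally show ?thesis by simp
qed

text \<open>If two of the first \<open>p\<close> iterates agreed, \<open>x\<close> would have a second period, coprime to \<open>p\<close>,
  and so would be fixed.\<close>

lemma card_orbit_of_prime_period:
  fixes p :: nat
  assumes p: "prime p" and period: "(f ^^ p) x = x" and moved: "f x \<noteq> x"
  shows "card (range (\<lambda>i. (f ^^ i) x)) = p"
proof -
  have "p > 0" using p by (simp add: prime_gt_0_nat)
  have "range (\<lambda>i. (f ^^ i) x) = (\<lambda>i. (f ^^ i) x) ` {..<p}"
  proof (intro equalityI subsetI)
    fix y assume "y \<in> range (\<lambda>i. (f ^^ i) x)"
    then obtain i where "y = (f ^^ i) x" by auto
    then have "y = (f ^^ (i mod p)) x"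
      using funpow_mod_eq[OF period] by simp
    then show "y \<in> (\<lambda>i. (f ^^ i) x) ` {..<p}"
      using \<open>p > 0\<close> by auto
  qed auto
  moreover have "False" if "i < j" "j < p" "(f ^^ i) x = (f ^^ j) x" for i j
  proof -
    have "(f ^^ (p - j + i)) x = (f ^^ (p - j + j)) x"
      using that(3) by (simp only: funpow_add o_apply)
    then have "(f ^^ (p - j + i)) x = x"
      using that period by simp
    moreover have "coprime (p - j + i) p"
      using that p by (metis add.commute add_gr_0 coprime_commute
          le_add_diff_inverse2 less_imp_le_nat nat_add_left_cancel_less nat_dvd_not_less
          prime_imp_coprime zero_less_diff)
    ultimately show False
      using funpow_coprime_fixed[OF _ period] moved by blast
  qed
  then have "inj_on (\<lambda>i. (f ^^ i) x) {..<p}"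
    by (intro inj_onI) (metis lessThan_iff nat_neq_iff)
  ultimately show ?thesis
    by (simp add: card_image)
qed

text \<open>The class equation for an action of the cyclic group of order \<open>p\<close>. Removing the orbit of a
  point that moves lowers the cardinality by \<open>p\<close> and does not affect the fixed points.\<close>

lemma card_fixed_points_cong:
  fixes p :: nat
  assumes p: "prime p" and "finite X"
    and "\<And>x. x \<in> X \<Longrightarrow> f x \<in> X" and "\<And>x. x \<in> X \<Longrightarrow> (f ^^ p) x = x"
  shows "[card X = card {x \<in> X. f x = x}] (mod p)"
  using assms(2-)
proof (induction X rule: finite_psubset_induct)
  case (psubset X)
  note closed = psubset.prems(1) and period = psubset.prems(2)
  show ?case
  proof (cases "\<forall>x\<in>X. f x = x")
    case True
    then have "{x \<in> X. f x = x} = X" by auto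
    then show ?thesis by simp
  next
    case False
    then obtain x where x: "x \<in> X" "f x \<noteq> x" by auto
    define B where "B = range (\<lambda>i. (f ^^ i) x)"
    have funpow_closed: "(f ^^ i) x \<in> X" for i
      using x(1) closed by (induction i) auto
    have "p > 0" using p by (simp add: prime_gt_0_nat)
    have B_sub: "B \<subseteq> X" using funpow_closed by (auto simp: B_def)
    have "x \<in> B" unfolding B_def by (rule range_eqI[of _ _ 0]) simp
    have card_B: "card B = p"
      unfolding B_def by (rule card_orbit_of_prime_period[OF p period[OF x(1)] x(2)])
    have rest_closed: "f y \<in> X - B" if y: "y \<in> X - B" for y
    proof -
      have "f y \<notin> B"
      proof
        assume "f y \<in> B"
        then obtain j where j: "f y = (f ^^ j) x" by (auto simp: B_def)
        have "y = (f ^^ (p - 1)) (f y)"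
          using period[of y] y \<open>p > 0\<close> by (metis DiffD1 Suc_diff_1 funpow_simps_right(2) o_apply)
        also have "\<dots> = (f ^^ (p - 1 + j)) x"
          using j by (simp add: funpow_add)
        finally show False using y by (auto simp: B_def)
      qed
      then show ?thesis using closed y by auto
    qed
    \<comment> \<open>A fixed point in the orbit of \<open>x\<close> would be equal to \<open>x\<close>, as iterating further leads back to \<open>x\<close>.\<close>
    have B_moved: "f y \<noteq> y" if y: "y \<in> B" for y
    proof
      assume fix_y: "f y = y"
      obtain i where i: "y = (f ^^ i) x" using y by (auto simp: B_def)
      have "(f ^^ m) y = y" for m
        using fix_y by (induction m) auto
      then have "(f ^^ (m + i)) x = y" for m
        using i by (simp add: funpow_add)
      moreover have "(f ^^ (p * i)) x = x"
        using funpow_mod_eq[OF period[OF x(1)], of "p * i"] by simp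
      moreover have "p * i = p * i - i + i"
        using \<open>p > 0\<close> by simp
      ultimately have "x = y" by metis
      then show False using fix_y x by simp
    qed
    have "[card (X - B) = card {x \<in> X - B. f x = x}] (mod p)"
    proof (rule psubset.IH)
      show "X - B \<subset> X" using \<open>x \<in> B\<close> x by auto
    qed (use rest_closed period in auto)
    moreover have "{x \<in> X - B. f x = x} = {x \<in> X. f x = x}"
      using B_moved by auto
    moreover have "card X = card (X - B) + p"
      using B_sub card_B psubset.hyps
      by (metis card_Diff_subset card_mono finite_subset le_add_diff_inverse2)
    ultimately show ?thesis by (simp add: cong_def)
  qed
qed

section \<open>Factorisations of an abelian group with a factor of prime size\<close>

text \<open>The term \<open>foldr (\<otimes>) xs g\<close> is the product of the entries of \<open>xs\<close> with \<open>g\<close>; keeping the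
  translate \<open>g\<close> as the start value avoids separate products of lists.\<close>

lemma (in comm_monoid) foldr_mult_closed:
  "set xs \<subseteq> carrier G \<Longrightarrow> g \<in> carrier G \<Longrightarrow> foldr (\<otimes>) xs g \<in> carrier G"
  by (induction xs) auto

lemma (in comm_monoid) foldr_mult_rotate1:
  assumes "set xs \<subseteq> carrier G" "g \<in> carrier G"
  shows "foldr (\<otimes>) (rotate1 xs) g = foldr (\<otimes>) xs g"
proof (cases xs)
  case (Cons a ys)
  have "foldr (\<otimes>) ys (a \<otimes> g) = a \<otimes> foldr (\<otimes>) ys g" if "set ys \<subseteq> carrier G" "a \<in> carrier G"
    using that assms(2) by (induction ys) (auto simp: foldr_mult_closed m_lcomm)
  then show ?thesis using assms Cons by simp
qed simp

lemma (in comm_monoid) foldr_mult_replicate: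
  assumes "a \<in> carrier G" "g \<in> carrier G"
  shows "foldr (\<otimes>) (replicate k a) g = (a [^] k) \<otimes> g"
  using assms by (induction k) (auto simp: m_ac)

text \<open>The last \<open>k\<close> entries can be chosen freely, and the factorisation then determines the first
  entry. In the group ring of an abelian group, with \<open>B\<close> the set of inverses of elements of \<open>A\<close>,
  this is the identity \<open>B\<^bsup>k+1\<^esup> C = |A|\<^sup>k G\<close>.\<close>

lemma (in comm_monoid) card_foldr_mult_lists:
  assumes A: "A \<subseteq> carrier G" "finite A" and g: "g \<in> carrier G"
    and tiling: "\<And>g. g \<in> carrier G \<Longrightarrow> \<exists>!a. a \<in> A \<and> a \<otimes> g \<in> C"
  shows "card {xs. set xs \<subseteq> A \<and> length xs = Suc k \<and> foldr (\<otimes>) xs g \<in> C} = card A ^ k"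
proof -
  let ?X = "{xs. set xs \<subseteq> A \<and> length xs = Suc k \<and> foldr (\<otimes>) xs g \<in> C}"
  let ?Y = "{ys. set ys \<subseteq> A \<and> length ys = k}"
  have unique: "\<exists>!a. a \<in> A \<and> a \<otimes> foldr (\<otimes>) ys g \<in> C" if "set ys \<subseteq> A" for ys
    using tiling[OF foldr_mult_closed[of ys g]] that A g by blast
  have "bij_betw tl ?X ?Y"
    unfolding bij_betw_def
  proof (intro conjI equalityI subsetI inj_onI)
    fix xs xs' assume *: "xs \<in> ?X" "xs' \<in> ?X" "tl xs = tl xs'"
    then obtain a a' ys where "xs = a # ys" "xs' = a' # ys"
      by (cases xs; cases xs') auto
    then show "xs = xs'" using * unique[of ys] by auto
  next
    fix ys assume "ys \<in> tl ` ?X"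
    then show "ys \<in> ?Y" by (auto simp: length_Suc_conv)
  next
    fix ys assume ys: "ys \<in> ?Y"
    then obtain a where "a \<in> A" "a \<otimes> foldr (\<otimes>) ys g \<in> C"
      using unique by blast
    then have "a # ys \<in> ?X" using ys by auto
    then show "ys \<in> tl ` ?X" by (intro image_eqI[of _ tl "a # ys"]) auto
  qed
  then show ?thesis
    using card_lists_length_eq[OF A(2), of k] by (simp add: bij_betw_same_card)
qed

text \<open>The \<open>p\<close>-tuples over \<open>A\<close> whose product moves \<open>g\<close> into \<open>C\<close> number \<open>p\<^bsup>p-1\<^esup>\<close>, a multiple of \<open>p\<close>.
  Rotation permutes them with \<open>p\<close>-th iterate the identity, so the number of constant ones is also
  a multiple of \<open>p\<close>.\<close>

lemma (in comm_monoid) prime_dvd_card_power_translates: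
  fixes p :: nat
  assumes p: "prime p" and A: "A \<subseteq> carrier G" "card A = p" and g: "g \<in> carrier G"
    and tiling: "\<And>g. g \<in> carrier G \<Longrightarrow> \<exists>!a. a \<in> A \<and> a \<otimes> g \<in> C"
  shows "p dvd card {a \<in> A. (a [^] p) \<otimes> g \<in> C}"
proof -
  have "p > 1" using prime_gt_1_nat[OF p] .
  have "finite A" using A(2) \<open>p > 1\<close> by (intro card_ge_0_finite) simp
  define X where "X = {xs. set xs \<subseteq> A \<and> length xs = p \<and> foldr (\<otimes>) xs g \<in> C}"
  have "finite X"
    using finite_lists_length_eq[OF \<open>finite A\<close>, of p]
    by (rule rev_finite_subset) (auto simp: X_def)
  have "card X = p ^ (p - 1)"
    using card_foldr_mult_lists[OF A(1) \<open>finite A\<close> g tiling, of "p - 1"] A(2) \<open>p > 1\<close>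
    by (simp add: X_def)
  then have "p dvd card X"
    using \<open>p > 1\<close> by simp
  moreover have "[card X = card {xs \<in> X. rotate1 xs = xs}] (mod p)"
  proof (rule card_fixed_points_cong[OF p \<open>finite X\<close>])
    fix xs assume xs: "xs \<in> X"
    then show "rotate1 xs \<in> X"
      using A(1) g by (auto simp: X_def foldr_mult_rotate1)
    have "rotate p xs = xs"
      using xs by (auto simp: X_def)
    then show "(rotate1 ^^ p) xs = xs"
      by (simp add: rotate_def)
  qed
  moreover have power: "foldr (\<otimes>) (replicate p a) g = (a [^] p) \<otimes> g" if "a \<in> A" for a
    using foldr_mult_replicate[of a g p] that A(1) g by blast
  have "{xs \<in> X. rotate1 xs = xs} = replicate p ` {a \<in> A. (a [^] p) \<otimes> g \<in> C}"
  proof (intro equalityI subsetI)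
    fix xs assume xs: "xs \<in> {xs \<in> X. rotate1 xs = xs}"
    then have len: "length xs = p" by (simp add: X_def)
    then have "xs \<noteq> []" using \<open>p > 1\<close> by auto
    then obtain a where a: "set xs = {a}"
      using xs rotate1_fixpoint_card[of xs] by (auto simp: card_1_singleton_iff)
    then have "xs = replicate p a"
      using len by (metis replicate_eqI singletonD)
    then show "xs \<in> replicate p ` {a \<in> A. (a [^] p) \<otimes> g \<in> C}"
      using xs a power by (auto simp: X_def simp del: foldr_replicate)
  next
    fix xs assume "xs \<in> replicate p ` {a \<in> A. (a [^] p) \<otimes> g \<in> C}"
    then show "xs \<in> {xs \<in> X. rotate1 xs = xs}"
      using power by (auto simp: X_def simp del: foldr_replicate)
  qed
  moreover have "inj_on (replicate p) {a \<in> A. (a [^] p) \<otimes> g \<in> C}"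
    using \<open>p > 1\<close> by (intro inj_onI) simp
  then have "card (replicate p ` {a \<in> A. (a [^] p) \<otimes> g \<in> C}) =
      card {a \<in> A. (a [^] p) \<otimes> g \<in> C}"
    by (rule card_image)
  ultimately show ?thesis
    using cong_dvd_iff by metis
qed

text \<open>The number of \<open>a \<in> A\<close> with \<open>a\<^sup>p c \<in> C\<close> is a multiple of \<open>p\<close> and is at most \<open>p\<close>. It is not
  \<open>0\<close>, since \<open>\<one>\<close> is counted, so every element of \<open>A\<close> is counted.\<close>

lemma (in comm_monoid) tiling_absorbs_powers:
  fixes p :: nat
  assumes p: "prime p" and A: "A \<subseteq> carrier G" "card A = p" "\<one> \<in> A"
    and tiling: "\<And>g. g \<in> carrier G \<Longrightarrow> \<exists>!a. a \<in> A \<and> a \<otimes> g \<in> C"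
    and C: "C \<subseteq> carrier G" "c \<in> C" and a: "a \<in> A"
  shows "(a [^] p) \<otimes> c \<in> C"
proof -
  let ?D = "{a \<in> A. (a [^] p) \<otimes> c \<in> C}"
  have fin: "finite A"
    using A(2) prime_gt_0_nat[OF p] by (intro card_ge_0_finite) simp
  have "p dvd card ?D"
    using prime_dvd_card_power_translates[OF p A(1,2) _ tiling] C by blast
  moreover have "\<one> \<in> ?D" using A(3) C by auto
  then have "card ?D > 0" using fin by (auto simp: card_gt_0_iff)
  ultimately have "card A \<le> card ?D"
    using A(2) by (simp add: dvd_imp_le)
  then have "?D = A"
    using fin by (intro card_seteq) auto
  then show ?thesis using a by blast
qed

text \<open>In an abelian group the elements whose \<open>p\<close>-th power maps \<open>C\<close> into itself are closed under
  products, so the previous lemma extends from \<open>S\<close> to what it generates.\<close>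

lemma (in comm_group) tiling_absorbs_powers_of_generated:
  fixes p :: nat
  assumes p: "prime p" and A: "insert \<one> S \<subseteq> carrier G" "card (insert \<one> S) = p"
    and inverse_closed: "m_inv G ` S = S"
    and tiling: "\<And>g. g \<in> carrier G \<Longrightarrow> \<exists>!s. s \<in> insert \<one> S \<and> s \<otimes> g \<in> C"
    and C: "C \<subseteq> carrier G" and c: "c \<in> C" and h: "h \<in> generate G S"
  shows "(h [^] p) \<otimes> c \<in> C"
  using h c
proof (induction arbitrary: c)
  case one
  then show ?case using C by auto
next
  case (incl h)
  then show ?case
    using tiling_absorbs_powers[OF p A _ tiling C] by blast
next
  case (inv h)
  then have "inv h \<in> insert \<one> S" using inverse_closed by blast
  then show ?case
    using tiling_absorbs_powers[OF p A _ tiling C inv.prems] by blast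
next
  case (eng h h')
  have carr: "h \<in> carrier G" "h' \<in> carrier G"
    using eng.hyps A(1) generate_in_carrier[of S] by auto
  have "((h \<otimes> h') [^] p) \<otimes> c = (h [^] p) \<otimes> ((h' [^] p) \<otimes> c)"
    using carr eng.prems C by (auto simp: nat_pow_distrib m_assoc)
  then show ?case using eng by simp
qed

section \<open>Perfect codes as factorisations\<close>

text \<open>An arc from \<open>v\<close> to \<open>c\<close> is an element \<open>s = c v\<^sup>-\<^sup>1\<close> of \<open>S\<close> with \<open>s v = c\<close>. Adding \<open>\<one>\<close> to \<open>S\<close>
  lets a vertex of \<open>C\<close> be dominated by itself, and uniqueness at such a vertex says that it has no
  neighbour in \<open>C\<close>; thus one condition expresses both halves of the definition of a perfect
  code.\<close>

lemma (in group) perfect_code_Cay_iff: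
  assumes S: "S \<subseteq> carrier G - {\<one>}"
  shows "perfect_code (Cay G S) C \<longleftrightarrow>
    C \<subseteq> carrier G \<and> (\<forall>v\<in>carrier G. \<exists>!s. s \<in> insert \<one> S \<and> s \<otimes> v \<in> C)"
    (is "?lhs \<longleftrightarrow> ?rhs")
proof
  assume L: ?lhs
  then have C: "C \<subseteq> carrier G" by (simp add: perfect_code_def Cay_def)
  have indep: "c' \<otimes> inv c \<notin> S" if "c \<in> C" "c' \<in> C" for c c'
  proof -
    have "(c, c') \<notin> parcs (Cay G S)"
      using L that by (simp add: perfect_code_def)
    then show ?thesis using that C by (auto simp: Cay_def)
  qed
  have dom: "\<exists>!c. c \<in> C \<and> c \<otimes> inv v \<in> S" if "v \<in> carrier G - C" for v
  proof -
    have "\<exists>!c. c \<in> C \<and> (v, c) \<in> parcs (Cay G S)"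
      using L that by (simp add: perfect_code_def Cay_def)
    then show ?thesis using that C by (auto simp: Cay_def)
  qed
  have "\<exists>!s. s \<in> insert \<one> S \<and> s \<otimes> v \<in> C" if v: "v \<in> carrier G" for v
  proof -
    have quotient: "s = (s \<otimes> v) \<otimes> inv v" if "s \<in> S" for s
      using that S v by (simp add: m_assoc subset_iff)
    show ?thesis
    proof (cases "v \<in> C")
      case True
      then have "s \<otimes> v \<notin> C" if "s \<in> S" for s
        using indep[of v "s \<otimes> v"] quotient[OF that] that by auto
      then show ?thesis using True v by auto
    next
      case False
      then obtain c where c: "c \<in> C" "c \<otimes> inv v \<in> S"
        and uniq: "\<And>c'. c' \<in> C \<Longrightarrow> c' \<otimes> inv v \<in> S \<Longrightarrow> c' = c"
        using dom[of v] v by auto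
      have "(c \<otimes> inv v) \<otimes> v = c"
        using c C v by (simp add: m_assoc subset_iff)
      moreover have "s = c \<otimes> inv v" if "s \<in> insert \<one> S" "s \<otimes> v \<in> C" for s
      proof -
        have "s \<in> S" using that False v by auto
        then show ?thesis using uniq[of "s \<otimes> v"] quotient[of s] that by simp
      qed
      ultimately show ?thesis
        using c by (intro ex1I[of _ "c \<otimes> inv v"]) auto
    qed
  qed
  then show ?rhs using C by simp
next
  assume R: ?rhs
  then have C: "C \<subseteq> carrier G"
    and tiling: "\<And>v. v \<in> carrier G \<Longrightarrow> \<exists>!s. s \<in> insert \<one> S \<and> s \<otimes> v \<in> C"
    by auto
  have arc: "(v, c) \<in> parcs (Cay G S) \<longleftrightarrow> c \<otimes> inv v \<in> S" if "v \<in> carrier G" "c \<in> C" for v c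
    using that C by (auto simp: Cay_def)
  have cancel: "(c \<otimes> inv v) \<otimes> v = c" if "v \<in> carrier G" "c \<in> C" for v c
    using that C by (simp add: m_assoc subset_iff)
  have "c' \<otimes> inv c \<notin> S" if c: "c \<in> C" "c' \<in> C" for c c'
  proof
    assume "c' \<otimes> inv c \<in> S"
    moreover have "\<one> \<otimes> c \<in> C" "c \<in> carrier G" using c C by auto
    ultimately have "c' \<otimes> inv c = \<one>"
      using tiling[of c] cancel[of c c'] c by (metis insertCI)
    then show False using \<open>c' \<otimes> inv c \<in> S\<close> S by auto
  qed
  moreover have "\<exists>!c. c \<in> C \<and> c \<otimes> inv v \<in> S" if v: "v \<in> carrier G - C" for v
  proof -
    obtain s where s: "s \<in> insert \<one> S" "s \<otimes> v \<in> C"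
      and uniq: "\<And>s'. s' \<in> insert \<one> S \<Longrightarrow> s' \<otimes> v \<in> C \<Longrightarrow> s' = s"
      using tiling[of v] v by auto
    have "s \<in> S" using s v by auto
    then have "(s \<otimes> v) \<otimes> inv v = s"
      using S v by (simp add: m_assoc subset_iff)
    moreover have "c = s \<otimes> v" if "c \<in> C" "c \<otimes> inv v \<in> S" for c
      using uniq[of "c \<otimes> inv v"] cancel[of v c] that v by auto
    ultimately show ?thesis
      using s(2) \<open>s \<in> S\<close> by metis
  qed
  moreover have "pverts (Cay G S) = carrier G" by (simp add: Cay_def)
  ultimately show ?lhs
    unfolding perfect_code_def using C by (simp add: arc subset_iff cong: conj_cong)
qed

section \<open>Multiples of a prime in a product of cyclic groups\<close>

lemma comm_group_Z_prod: "comm_group (Z_prod d n)"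
proof -
  have "group (Z_prod d n)" by (simp add: Z_prod_def)
  then show ?thesis
    by (rule group.group_comm_groupI) (auto simp: Z_prod_def add.commute)
qed

lemma carrier_Z_prod:
  assumes "\<And>i. i \<in> {1..d} \<Longrightarrow> n i > 0"
  shows "carrier (Z_prod d n) = (\<Pi>\<^sub>E i\<in>{1..d}. {0..<int (n i)})"
  unfolding Z_prod_def carrier_product_group
  by (intro PiE_cong) (use assms in \<open>simp add: carrier_integer_mod_group\<close>)

lemma mult_Z_prod:
  "i \<in> {1..d} \<Longrightarrow> (x \<otimes>\<^bsub>Z_prod d n\<^esub> y) i = (x i + y i) mod int (n i)"
  by (simp add: Z_prod_def)

lemma one_Z_prod: "i \<in> {1..d} \<Longrightarrow> \<one>\<^bsub>Z_prod d n\<^esub> i = 0"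
  by (simp add: Z_prod_def)

lemma pow_Z_prod:
  fixes k :: nat
  assumes "i \<in> {1..d}"
  shows "(x [^]\<^bsub>Z_prod d n\<^esub> k) i = (int k * x i) mod int (n i)"
proof (induction k)
  case 0
  then show ?case using assms by (simp add: one_Z_prod)
next
  case (Suc k)
  then show ?case using assms by (simp add: mult_Z_prod algebra_simps mod_simps)
qed

text \<open>The equation \<open>p h = x\<close> is solved coordinatewise: for \<open>i \<noteq> t\<close> the prime \<open>p\<close> is invertible modulo
  \<open>n\<^sub>i\<close>, and in coordinate \<open>t\<close> the integer \<open>x\<^sub>t\<close> is itself a multiple of \<open>p\<close>.\<close>

lemma Z_prod_prime_multiple:
  fixes p :: nat
  assumes n: "\<And>i. i \<in> {1..d} \<Longrightarrow> n i > 0" and p: "prime p"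
    and t: "{i \<in> {1..d}. p dvd n i} = {t}"
    and x: "x \<in> carrier (Z_prod d n)" "[x t = 0] (mod int p)"
  shows "\<exists>h\<in>carrier (Z_prod d n). h [^]\<^bsub>Z_prod d n\<^esub> p = x"
proof -
  interpret G: comm_group "Z_prod d n" by (rule comm_group_Z_prod)
  have carrier: "carrier (Z_prod d n) = (\<Pi>\<^sub>E i\<in>{1..d}. {0..<int (n i)})"
    using carrier_Z_prod[of d n] n by blast
  have "\<exists>y. [int p * y = x i] (mod int (n i))" if i: "i \<in> {1..d}" for i
  proof (cases "i = t")
    case True
    then obtain k where "x i = int p * k" using x(2) by (auto simp: cong_0_iff)
    then show ?thesis by (metis cong_refl)
  next
    case False
    then have "coprime (int p) (int (n i))"
      using t i p prime_imp_coprime by auto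
    then obtain z where "[int p * z = 1] (mod int (n i))"
      using cong_solve_coprime_int by blast
    then have "[int p * z * x i = 1 * x i] (mod int (n i))"
      by (rule cong_scalar_right)
    then show ?thesis by (metis mult.assoc mult_1)
  qed
  then obtain y where y: "\<And>i. i \<in> {1..d} \<Longrightarrow> [int p * y i = x i] (mod int (n i))"
    by metis
  define h where "h = (\<lambda>i\<in>{1..d}. y i mod int (n i))"
  have h: "h \<in> carrier (Z_prod d n)"
    unfolding carrier h_def using n by (auto simp: PiE_iff)
  have "(h [^]\<^bsub>Z_prod d n\<^esub> p) i = x i" for i :: nat
  proof (cases "i \<in> {1..d}")
    case True
    have "0 \<le> x i" "x i < int (n i)"
      using x(1) True by (auto simp: carrier PiE_iff)
    then show ?thesis
      using True y[OF True] by (simp add: pow_Z_prod h_def mod_mult_right_eq cong_def)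
  next
    case False
    then show ?thesis
      using x(1) G.nat_pow_closed[OF h, of p] unfolding carrier by (metis PiE_arb)
  qed
  then have "h [^]\<^bsub>Z_prod d n\<^esub> p = x" by (rule ext)
  then show ?thesis using h by (rule bexI)
qed

text \<open>When \<open>p\<close> divides \<open>n\<^sub>i\<close>, reducing the \<open>i\<close>-th coordinate modulo \<open>p\<close> is a homomorphism.\<close>

lemma mult_Z_prod_cong:
  assumes "i \<in> {1..d}" "p dvd n i"
  shows "[(x \<otimes>\<^bsub>Z_prod d n\<^esub> y) i = x i + y i] (mod int p)"
  using assms by (simp add: mult_Z_prod cong_def mod_mod_cancel)

lemma inv_Z_prod_cong:
  assumes "i \<in> {1..d}" "p dvd n i" "x \<in> carrier (Z_prod d n)"
  shows "[(inv\<^bsub>Z_prod d n\<^esub> x) i = - x i] (mod int p)"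
proof -
  interpret G: comm_group "Z_prod d n" by (rule comm_group_Z_prod)
  have "[(inv\<^bsub>Z_prod d n\<^esub> x) i + x i = 0] (mod int p)"
    using mult_Z_prod_cong[of i d p n "inv\<^bsub>Z_prod d n\<^esub> x" x] assms
    by (simp add: one_Z_prod cong_sym_eq)
  then show ?thesis
    using cong_add_rcancel[of _ "x i" "- x i" "int p"] by simp
qed

section \<open>The criterion\<close>

theorem theorem4p3:
  fixes d p t :: nat and n :: "nat \<Rightarrow> nat"
    and G :: "(nat \<Rightarrow> int) monoid" and S S\<^sub>0 :: "(nat \<Rightarrow> int) set"
  assumes n_ge_2: "\<And>i. i \<in> {1..d} \<Longrightarrow> n i \<ge> 2"
    and G: "G = Z_prod d n"
    and S_subset: "S \<subseteq> carrier G - {\<one>\<^bsub>G\<^esub>}"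
    and S_inverse_closed: "m_inv G ` S = S"
    and S_generates: "generate G S = carrier G"
    and S\<^sub>0: "S\<^sub>0 = S \<union> {\<one>\<^bsub>G\<^esub>}"
    and prime_p: "prime p" and card_S\<^sub>0: "card S\<^sub>0 = p"
    and exactly_one: "{i \<in> {1..d}. p dvd n i} = {t}"
  shows "(\<exists>C. perfect_code (Cay G S) C) \<longleftrightarrow>
    (\<forall>s\<in>S\<^sub>0. \<forall>s'\<in>S\<^sub>0. s \<noteq> s' \<longrightarrow> \<not> [s t = s' t] (mod int p))"
proof
  interpret comm_group G unfolding G by (rule comm_group_Z_prod)
  have t: "t \<in> {1..d}" "p dvd n t" using exactly_one by auto
  have n_pos: "n i > 0" if "i \<in> {1..d}" for i using n_ge_2[OF that] by simp
  have S\<^sub>0_insert: "S\<^sub>0 = insert \<one>\<^bsub>G\<^esub> S" using S\<^sub>0 by simp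
  have S\<^sub>0_carrier: "S\<^sub>0 \<subseteq> carrier G" using S\<^sub>0 S_subset by auto
  note code_iff = perfect_code_Cay_iff[OF S_subset, folded S\<^sub>0_insert]
  note mult_t = mult_Z_prod_cong[of t d p n, folded G, OF t]
  note inv_t = inv_Z_prod_cong[of t d p n, folded G, OF t]
  {
    assume "\<exists>C. perfect_code (Cay G S) C"
    then obtain C where C: "C \<subseteq> carrier G"
      and tiling: "\<And>v. v \<in> carrier G \<Longrightarrow> \<exists>!s. s \<in> S\<^sub>0 \<and> s \<otimes>\<^bsub>G\<^esub> v \<in> C"
      using code_iff by auto
    obtain c where c: "c \<in> C" "c \<in> carrier G"
      using tiling[OF one_closed] C by blast
    show "\<forall>s\<in>S\<^sub>0. \<forall>s'\<in>S\<^sub>0. s \<noteq> s' \<longrightarrow> \<not> [s t = s' t] (mod int p)"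
    proof (intro ballI impI notI)
      fix s s' assume s: "s \<in> S\<^sub>0" "s' \<in> S\<^sub>0" "s \<noteq> s'" "[s t = s' t] (mod int p)"
      have carr: "s \<in> carrier G" "s' \<in> carrier G" using s S\<^sub>0_carrier by auto
      have "[(s' \<otimes>\<^bsub>G\<^esub> inv\<^bsub>G\<^esub> s) t = s' t + (inv\<^bsub>G\<^esub> s) t] (mod int p)"
        by (rule mult_t)
      also have "[s' t + (inv\<^bsub>G\<^esub> s) t = s' t + - s t] (mod int p)"
        by (intro cong_add cong_refl inv_t carr)
      also have "[s' t + - s t = 0] (mod int p)"
        using s(4) by (simp add: cong_diff_iff_cong_0 cong_sym)
      \<comment> \<open>The quotient of \<open>s'\<close> by \<open>s\<close> is a \<open>p\<close>-th power, so \<open>C\<close> absorbs it.\<close>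
      finally obtain h where h: "h \<in> carrier G" "h [^]\<^bsub>G\<^esub> p = s' \<otimes>\<^bsub>G\<^esub> inv\<^bsub>G\<^esub> s"
        using Z_prod_prime_multiple[of d n p t "s' \<otimes>\<^bsub>G\<^esub> inv\<^bsub>G\<^esub> s", OF n_pos prime_p exactly_one,
            folded G] carr
        by auto
      have "(h [^]\<^bsub>G\<^esub> p) \<otimes>\<^bsub>G\<^esub> c \<in> C"
      proof (rule tiling_absorbs_powers_of_generated[OF prime_p _ _ S_inverse_closed _ C c(1)])
        show "h \<in> generate G S" using h S_generates by simp
      qed (use S\<^sub>0_carrier card_S\<^sub>0 tiling S\<^sub>0_insert in simp_all)
      then have "s' \<otimes>\<^bsub>G\<^esub> (inv\<^bsub>G\<^esub> s \<otimes>\<^bsub>G\<^esub> c) \<in> C"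
        using h carr c by (simp add: m_assoc)
      \<comment> \<open>Both \<open>s\<close> and \<open>s'\<close> move the vertex \<open>inv s \<otimes> c\<close> into \<open>C\<close>.\<close>
      moreover have "s \<otimes>\<^bsub>G\<^esub> (inv\<^bsub>G\<^esub> s \<otimes>\<^bsub>G\<^esub> c) \<in> C"
        using carr c by (simp add: m_assoc[symmetric])
      ultimately show False
        using tiling[of "inv\<^bsub>G\<^esub> s \<otimes>\<^bsub>G\<^esub> c"] s carr c by auto
    qed
  next
    assume distinct: "\<forall>s\<in>S\<^sub>0. \<forall>s'\<in>S\<^sub>0. s \<noteq> s' \<longrightarrow> \<not> [s t = s' t] (mod int p)"
    have "p > 0" using prime_p by (simp add: prime_gt_0_nat)
    \<comment> \<open>The kernel of reducing the \<open>t\<close>-th coordinate modulo \<open>p\<close>.\<close>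
    define C where "C = {x \<in> carrier G. [x t = 0] (mod int p)}"
    have "inj_on (\<lambda>s. s t mod int p) S\<^sub>0"
      using distinct by (intro inj_onI) (auto simp: cong_def)
    then have "card ((\<lambda>s. s t mod int p) ` S\<^sub>0) = card {0..<int p}"
      by (simp add: card_image card_S\<^sub>0)
    then have residues: "(\<lambda>s. s t mod int p) ` S\<^sub>0 = {0..<int p}"
      using \<open>p > 0\<close> by (intro card_subset_eq) auto
    have in_C: "s \<otimes>\<^bsub>G\<^esub> v \<in> C \<longleftrightarrow> [s t = - v t] (mod int p)"
      if "s \<in> S\<^sub>0" "v \<in> carrier G" for s v
    proof -
      have "s \<otimes>\<^bsub>G\<^esub> v \<in> C \<longleftrightarrow> [s t + v t = 0] (mod int p)"
        using that S\<^sub>0_carrier mult_t[of s v] unfolding C_def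
        by (auto intro: cong_trans cong_sym)
      also have "\<dots> \<longleftrightarrow> [s t = - v t] (mod int p)"
        using cong_add_rcancel[of "s t" "v t" "- v t" "int p"] by simp
      finally show ?thesis .
    qed
    have "\<exists>!s. s \<in> S\<^sub>0 \<and> s \<otimes>\<^bsub>G\<^esub> v \<in> C" if v: "v \<in> carrier G" for v
    proof -
      have "(- v t) mod int p \<in> (\<lambda>s. s t mod int p) ` S\<^sub>0"
        using residues \<open>p > 0\<close> by simp
      then obtain s where s: "s \<in> S\<^sub>0" "[s t = - v t] (mod int p)"
        by (auto simp: cong_def)
      moreover have "s' = s" if "s' \<in> S\<^sub>0" "[s' t = - v t] (mod int p)" for s'
        using distinct s that cong_trans cong_sym by blast
      ultimately show ?thesis using in_C v by blast
    qed
    then have "perfect_code (Cay G S) C"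
      using code_iff by (auto simp: C_def)
    then show "\<exists>C. perfect_code (Cay G S) C" ..
  }
qed

end
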